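(* Let $\Omega$ be a polytope whose edges have each been given an arbitrary orientation, and let $\Omega_1,\Omega_2,\Omega_3$ be three closed convex sets covering $\Omega$. Then there exists a nice $1$-skeleton cover $\mathcal{C}=\bigl((V_i),\lambda,(t_e),(u_e),(v_e)\bigr)$ of $\Omega$ such that $\overline{V_i}(\mathcal{C})\subseteq\Omega_i$ for all $i\in\{1,2,3\}$ and such that the three sets $\Omega_1,\Omega_2,\Omega_3$ have a common point on every face $f$ in $F(V_1,V_2,V_3,\lambda)$, i.e. $\Omega_1\cap\Omega_2\cap\Omega_3\cap f\neq\varnothing$ for all $f\in F(V_1,V_2,V_3,\lambda)$.
   Context: Let $\Omega\subset\mathbb{R}^n$ be a polytope with vertex set $V(\Omega)$ and edge set $E(\Omega)$; its $1$-skeleton is the union of its vertices and edges. Each edge $e$ is given an arbitrary fixed orientation, so it has a tail and a head. A nice $1$-skeleton cover of $\Omega$ is a tuple $\mathcal{C}=\bigl((V_i)_{i=1,2,3},\lambda,(t_e),(u_e),(v_e)\bigr)$ where: - $V_1,V_2,V_3$ are subsets of $V(\Omega)$ whose union is $V(\Omega)$; - $\lambda$ assigns to each edge $e$ a non-empty subset $\lambda(e)$ of $\{1,2,3\}$ such that (a) if $\lambda(e)=\{i\}$, then both endpoints of $e$ belong to $V_i$; (b) if $\lambda(e)=\{i,j\}$ with $i\neq j$, then $V_i$ contains one endpoint of $e$ and $V_j$ contains the other endpoint; (c) if $\lambda(e)=\{1,2,3\}$, then one of the $V_i$'s contains one endpoint of $e$, another one contains the other endpoint, and the last one contains no endpoint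 of $e$; - for each edge $e$ with $|\lambda(e)|=2$, $t_e$ is a point of $e$; - for each edge $e$ with $|\lambda(e)|=3$, $u_e$ and $v_e$ are points of $e$ such that the tail of $e$, $u_e$, $v_e$, and the head of $e$ are in this order on $e$ (possibly $u_e=v_e$). For such $\mathcal{C}$ and $i\in\{1,2,3\}$, $$\begin{aligned}\overline{V_i}(\mathcal{C})\coloneqq{}& V_i\cup\{t_e: i\in\lambda(e),\ |\lambda(e)|=2\}\\&\cup\{u_e,v_e: |\lambda(e)|=3,\ V_i\text{ contains no endpoint of }e\}\\&\cup\{u_e: |\lambda(e)|=3,\ V_i\text{ contains the tail of }e\}\\&\cup\{v_e: |\lambda(e)|=3,\ V_i\text{ contains the head of }e\}.\end{aligned}$$ The sets $\operatorname{conv}(\overline{V_i}(\mathcal{C}))$ cover the $1$-skeleton of $\Omega$. For closed convex sets $C_1,C_2,C_3$ covering the $1$-skeleton of $\Omega$, $F(C_1,C_2,C_3)$ is the set of two-dimensional faces $f$ of $\Omega$ (possibly $\Omega$ itself) such that the $C_i$'s are pairwise intersecting on the (relative) boundary $\partial f$, i.e. $C_i\cap C_j\cap\partial f\neq\varnothing$ for all $i\neq j$ (so it is empty if some $C_i$ is empty). For $V_1,V_2,V_3$ covering $V(\Omega)$ and $\lambda$ satisfying (a), (b), (c), set $$F(V_1,V_2,V_3,\lambda)\coloneqq F\bigl(\operatorname{conv}(\overline{V_1}(\mathcal{C}')),\operatorname{conv}(\overline{V_2}(\mathcal{C}')),\operatorname{conv}(\overline{V_3}(\mathcal{C}'))\bigr),$$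 where $\mathcal{C}'=\bigl((V_i),\lambda,(t'_e),(u'_e),(v'_e)\bigr)$ is any nice $1$-skeleton cover with the same $(V_i)$ and $\lambda$ for which all the points $t'_e,u'_e,v'_e$ are in the relative interiors of their edges $e$ and $u'_e\neq v'_e$ for all $e$ with $|\lambda(e)|=3$; this does not depend on the choice of such a $\mathcal{C}'$. *)

theory Defs
  imports "HOL-Analysis.Analysis"
begin

definition vertices :: "'a::euclidean_space set \<Rightarrow> 'a set" where
  "vertices \<Omega> = {x. x extreme_point_of \<Omega>}"

text \<open>The orientation of the edges is given by the functions \<open>tail\<close> (tail) and \<open>head\<close> (head).
  An edge has affine dimension one, so its tail and head are distinct and are its two
  endpoints.\<close>

definition edge_orientation ::
    "'a::euclidean_space set \<Rightarrow> ('a set \<Rightarrow> 'a) \<Rightarrow> ('a set \<Rightarrow> 'a) \<Rightarrow> bool" where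
  "edge_orientation \<Omega> tail head \<longleftrightarrow> (\<forall>e. e edge_of \<Omega> \<longrightarrow> e = closed_segment (tail e) (head e))"

text \<open>The conditions on the sets \<open>V\<^sub>i\<close> and on \<open>\<lambda>\<close>. The index set is \<open>{1,2,3}\<close>; values of
  \<open>V\<close> at other indices, and of \<open>lam\<close> at sets that are not edges, play no role. In the last
  clause, \<open>{i,j,k} = {1,2,3}\<close> says that \<open>i,j,k\<close> is a permutation of \<open>1,2,3\<close>.\<close>

definition vertex_edge_labelling ::
    "'a::euclidean_space set \<Rightarrow> ('a set \<Rightarrow> 'a) \<Rightarrow> ('a set \<Rightarrow> 'a)
      \<Rightarrow> (nat \<Rightarrow> 'a set) \<Rightarrow> ('a set \<Rightarrow> nat set) \<Rightarrow> bool" where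
  "vertex_edge_labelling \<Omega> tail head V lam \<longleftrightarrow>
     (\<forall>i\<in>{1,2,3}. V i \<subseteq> vertices \<Omega>) \<and>
     (\<Union>i\<in>{1,2,3}. V i) = vertices \<Omega> \<and>
     (\<forall>e. e edge_of \<Omega> \<longrightarrow>
        lam e \<noteq> {} \<and> lam e \<subseteq> {1,2,3} \<and>
        (\<forall>i. lam e = {i} \<longrightarrow> tail e \<in> V i \<and> head e \<in> V i) \<and>
        (\<forall>i j. i \<noteq> j \<and> lam e = {i,j} \<longrightarrow>
           tail e \<in> V i \<and> head e \<in> V j \<or> head e \<in> V i \<and> tail e \<in> V j) \<and>
        (lam e = {1,2,3} \<longrightarrow>
           (\<exists>i j k. {i,j,k} = {1,2,3} \<and> tail e \<in> V i \<and> head e \<in> V j \<and>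
              tail e \<notin> V k \<and> head e \<notin> V k)))"

definition nice_skeleton_cover ::
    "'a::euclidean_space set \<Rightarrow> ('a set \<Rightarrow> 'a) \<Rightarrow> ('a set \<Rightarrow> 'a)
      \<Rightarrow> (nat \<Rightarrow> 'a set) \<Rightarrow> ('a set \<Rightarrow> nat set)
      \<Rightarrow> ('a set \<Rightarrow> 'a) \<Rightarrow> ('a set \<Rightarrow> 'a) \<Rightarrow> ('a set \<Rightarrow> 'a) \<Rightarrow> bool" where
  "nice_skeleton_cover \<Omega> tail head V lam t u v \<longleftrightarrow>
     vertex_edge_labelling \<Omega> tail head V lam \<and>
     (\<forall>e. e edge_of \<Omega> \<and> card (lam e) = 2 \<longrightarrow> t e \<in> e) \<and>
     (\<forall>e. e edge_of \<Omega> \<and> card (lam e) = 3 \<longrightarrow>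
        u e \<in> e \<and> v e \<in> e \<and>
        u e \<in> closed_segment (tail e) (v e) \<and> v e \<in> closed_segment (u e) (head e))"

definition Vbar ::
    "'a::euclidean_space set \<Rightarrow> ('a set \<Rightarrow> 'a) \<Rightarrow> ('a set \<Rightarrow> 'a)
      \<Rightarrow> (nat \<Rightarrow> 'a set) \<Rightarrow> ('a set \<Rightarrow> nat set)
      \<Rightarrow> ('a set \<Rightarrow> 'a) \<Rightarrow> ('a set \<Rightarrow> 'a) \<Rightarrow> ('a set \<Rightarrow> 'a) \<Rightarrow> nat \<Rightarrow> 'a set" where
  "Vbar \<Omega> tail head V lam t u v i =
     V i
     \<union> {t e |e. e edge_of \<Omega> \<and> i \<in> lam e \<and> card (lam e) = 2}
     \<union> (\<Union>e\<in>{e. e edge_of \<Omega> \<and> card (lam e) = 3 \<and> tail e \<notin> V i \<and> head e \<notin> V i}. {u e, v e})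
     \<union> {u e |e. e edge_of \<Omega> \<and> card (lam e) = 3 \<and> tail e \<in> V i}
     \<union> {v e |e. e edge_of \<Omega> \<and> card (lam e) = 3 \<and> head e \<in> V i}"

definition faces_pairwise_meeting ::
    "'a::euclidean_space set \<Rightarrow> (nat \<Rightarrow> 'a set) \<Rightarrow> 'a set set" where
  "faces_pairwise_meeting \<Omega> C =
     {f. f face_of \<Omega> \<and> aff_dim f = 2 \<and>
         (\<forall>i\<in>{1,2,3}. \<forall>j\<in>{1,2,3}. i \<noteq> j \<longrightarrow> C i \<inter> C j \<inter> rel_frontier f \<noteq> {})}"

definition generic_skeleton_cover ::
    "'a::euclidean_space set \<Rightarrow> ('a set \<Rightarrow> 'a) \<Rightarrow> ('a set \<Rightarrow> 'a)
      \<Rightarrow> (nat \<Rightarrow> 'a set) \<Rightarrow> ('a set \<Rightarrow> nat set)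
      \<Rightarrow> ('a set \<Rightarrow> 'a) \<Rightarrow> ('a set \<Rightarrow> 'a) \<Rightarrow> ('a set \<Rightarrow> 'a) \<Rightarrow> bool" where
  "generic_skeleton_cover \<Omega> tail head V lam t u v \<longleftrightarrow>
     nice_skeleton_cover \<Omega> tail head V lam t u v \<and>
     (\<forall>e. e edge_of \<Omega> \<and> card (lam e) = 2 \<longrightarrow> t e \<in> rel_interior e) \<and>
     (\<forall>e. e edge_of \<Omega> \<and> card (lam e) = 3 \<longrightarrow>
        u e \<in> rel_interior e \<and> v e \<in> rel_interior e \<and> u e \<noteq> v e)"

text \<open>The set \<open>F(V\<^sub>1,V\<^sub>2,V\<^sub>3,\<lambda>)\<close>. The existential quantifier ranges over the generic covers with
  the given \<open>V\<close> and \<open>lam\<close>; by \<open>generic_skeleton_cover_exists\<close> and \<open>labelling_faces_eq\<close> below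
  there is such a cover and the set does not depend on which one is used.\<close>

definition labelling_faces ::
    "'a::euclidean_space set \<Rightarrow> ('a set \<Rightarrow> 'a) \<Rightarrow> ('a set \<Rightarrow> 'a)
      \<Rightarrow> (nat \<Rightarrow> 'a set) \<Rightarrow> ('a set \<Rightarrow> nat set) \<Rightarrow> 'a set set" where
  "labelling_faces \<Omega> tail head V lam =
     {f. \<exists>t u v. generic_skeleton_cover \<Omega> tail head V lam t u v \<and>
          f \<in> faces_pairwise_meeting \<Omega> (\<lambda>i. convex hull (Vbar \<Omega> tail head V lam t u v i))}"

lemma edge_tail_neq_head:
  assumes "edge_orientation \<Omega> tail head" "e edge_of \<Omega>"
  shows "tail e \<noteq> head e"
proof
  assume eq: "tail e = head e"
  have "e = closed_segment (tail e) (head e)"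
    using assms by (auto simp: edge_orientation_def)
  then have "e = {tail e}" using eq by simp
  then have "aff_dim e = 0" by (metis aff_dim_sing)
  then show False using assms(2) by (simp add: edge_of_def)
qed

abbreviation edge_point :: "('a set \<Rightarrow> 'a) \<Rightarrow> ('a set \<Rightarrow> 'a) \<Rightarrow> 'a set \<Rightarrow> real \<Rightarrow> 'a::euclidean_space" where
  "edge_point tail head e s \<equiv> tail e + s *\<^sub>R (head e - tail e)"

lemma edge_point_inj:
  assumes "edge_orientation \<Omega> tail head" "e edge_of \<Omega>"
  shows "inj (edge_point tail head e)"
  using edge_tail_neq_head[OF assms] by (auto simp: inj_on_def)

lemma edge_eq_image:
  assumes "edge_orientation \<Omega> tail head" "e edge_of \<Omega>"
  shows "e = edge_point tail head e ` {0..1}"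
proof -
  have "e = closed_segment (tail e) (head e)"
    using assms by (auto simp: edge_orientation_def)
  then show ?thesis
    by (simp add: closed_segment_image_interval algebra_simps)
qed

lemma rel_interior_edge_eq_image:
  assumes "edge_orientation \<Omega> tail head" "e edge_of \<Omega>"
  shows "rel_interior e = edge_point tail head e ` {0<..<1}"
proof -
  have "e = closed_segment (tail e) (head e)"
    using assms by (auto simp: edge_orientation_def)
  then have "rel_interior e = open_segment (tail e) (head e)"
    using edge_tail_neq_head[OF assms] by (metis rel_interior_closed_segment)
  then show ?thesis
    using edge_tail_neq_head[OF assms]
    by (simp add: open_segment_image_interval algebra_simps)
qed

lemma edge_point_between:
  assumes "edge_orientation \<Omega> tail head" "e edge_of \<Omega>" "0 \<le> a" "a \<le> b" "b \<le> 1"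
  shows "edge_point tail head e a \<in> closed_segment (tail e) (edge_point tail head e b)"
    and "edge_point tail head e b \<in> closed_segment (edge_point tail head e a) (head e)"
proof -
  have im: "edge_point tail head e ` closed_segment x y
      = closed_segment (edge_point tail head e x) (edge_point tail head e y)" for x y
  proof -
    have "edge_point tail head e ` S = (+) (tail e) ` ((\<lambda>s. s *\<^sub>R (head e - tail e)) ` S)" for S
      by (simp add: image_image)
    moreover have "(\<lambda>s. s *\<^sub>R (head e - tail e)) ` closed_segment x y =
        closed_segment (x *\<^sub>R (head e - tail e)) (y *\<^sub>R (head e - tail e))"
      by (rule closed_segment_linear_image[symmetric]) (simp add: linear_scaleR_left)
    ultimately show ?thesis
      by (simp add: closed_segment_translation)
  qed
  show "edge_point tail head e a \<in> closed_segment (tail e) (edge_point tail head e b)"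
    using im[of 0 b] assms by (force simp: closed_segment_eq_real_ivl)
  show "edge_point tail head e b \<in> closed_segment (edge_point tail head e a) (head e)"
    using im[of a 1] assms by (force simp: closed_segment_eq_real_ivl)
qed

lemma generic_skeleton_cover_exists:
  assumes or: "edge_orientation \<Omega> tail head" and lab: "vertex_edge_labelling \<Omega> tail head V lam"
  shows "\<exists>t u v. generic_skeleton_cover \<Omega> tail head V lam t u v"
proof -
  let ?p = "edge_point tail head"
  have *: "?p e s \<in> e" "?p e s \<in> rel_interior e" if "e edge_of \<Omega>" "0 < s" "s < 1" for e s
    using edge_eq_image[OF or that(1)] rel_interior_edge_eq_image[OF or that(1)] that by force+
  have "?p e (1/3) \<noteq> ?p e (2/3)" if "e edge_of \<Omega>" for e
    using edge_point_inj[OF or that] by (auto dest: injD)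
  then have "generic_skeleton_cover \<Omega> tail head V lam
      (\<lambda>e. ?p e (1/2)) (\<lambda>e. ?p e (1/3)) (\<lambda>e. ?p e (2/3))"
    unfolding generic_skeleton_cover_def nice_skeleton_cover_def
    using lab * edge_point_between[OF or, of _ "1/3" "2/3"] by auto
  then show ?thesis by blast
qed

lemma real_hulls_meet_iff:
  fixes A B :: "real set"
  shows "convex hull A \<inter> convex hull B \<noteq> {} \<longleftrightarrow>
    (\<exists>a\<in>A. \<exists>b\<in>B. a \<le> b) \<and> (\<exists>a\<in>A. \<exists>b\<in>B. b \<le> a)"
proof
  have *: "\<exists>a\<in>A. \<exists>b\<in>B. a \<le> b" if "x \<in> convex hull A" "x \<in> convex hull B" for x and A B :: "real set"
  proof (rule ccontr)
    assume neg: "\<not> ?thesis"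
    have "B \<subseteq> {..<x}"
    proof
      fix b assume "b \<in> B"
      then have "A \<subseteq> {b<..}" using neg by (auto simp: not_le)
      then have "convex hull A \<subseteq> {b<..}" by (intro hull_minimal) auto
      then show "b \<in> {..<x}" using that by auto
    qed
    then have "convex hull B \<subseteq> {..<x}" by (intro hull_minimal) auto
    then show False using that by auto
  qed
  assume "convex hull A \<inter> convex hull B \<noteq> {}"
  then show "(\<exists>a\<in>A. \<exists>b\<in>B. a \<le> b) \<and> (\<exists>a\<in>A. \<exists>b\<in>B. b \<le> a)"
    using *[of _ A B] *[of _ B A] by blast
next
  assume "(\<exists>a\<in>A. \<exists>b\<in>B. a \<le> b) \<and> (\<exists>a\<in>A. \<exists>b\<in>B. b \<le> a)"
  then obtain a1 a2 b1 b2 where ab: "a1 \<in> A" "a2 \<in> A" "b1 \<in> B" "b2 \<in> B" "a1 \<le> b1" "b2 \<le> a2"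
    by blast
  have "closed_segment a1 a2 \<subseteq> convex hull A" "closed_segment b1 b2 \<subseteq> convex hull B"
    using ab by (auto simp: segment_convex_hull intro!: hull_mono)
  moreover have "closed_segment a1 a2 \<inter> closed_segment b1 b2 \<noteq> {}"
    using ab by (auto simp: closed_segment_eq_real_ivl split: if_splits)
  ultimately show "convex hull A \<inter> convex hull B \<noteq> {}" by blast
qed

definition edge_params ::
    "('a set \<Rightarrow> 'a) \<Rightarrow> ('a set \<Rightarrow> 'a) \<Rightarrow> (nat \<Rightarrow> 'a set) \<Rightarrow> ('a set \<Rightarrow> nat set)
      \<Rightarrow> real \<Rightarrow> real \<Rightarrow> real \<Rightarrow> 'a set \<Rightarrow> nat \<Rightarrow> real set" where
  "edge_params tail head V lam \<tau> \<mu> \<nu> e i =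
     {s. s = 0 \<and> tail e \<in> V i \<or> s = 1 \<and> head e \<in> V i \<or>
         s = \<tau> \<and> i \<in> lam e \<and> card (lam e) = 2 \<or>
         s = \<mu> \<and> card (lam e) = 3 \<and> (tail e \<in> V i \<or> head e \<notin> V i) \<or>
         s = \<nu> \<and> card (lam e) = 3 \<and> (head e \<in> V i \<or> tail e \<notin> V i)}"

lemma edge_params_meet_mono:
  assumes "card (lam e) = 2 \<Longrightarrow> 0 < \<tau> \<and> \<tau> < 1 \<and> 0 < \<tau>' \<and> \<tau>' < 1"
    and "card (lam e) = 3 \<Longrightarrow> 0 < \<mu> \<and> \<mu> < \<nu> \<and> \<nu> < 1 \<and> 0 < \<mu>' \<and> \<mu>' < \<nu>' \<and> \<nu>' < 1"
    and "a \<in> edge_params tail head V lam \<tau> \<mu> \<nu> e i" "b \<in> edge_params tail head V lam \<tau> \<mu> \<nu> e j" "a \<le> b"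
  shows "\<exists>a'\<in>edge_params tail head V lam \<tau>' \<mu>' \<nu>' e i.
    \<exists>b'\<in>edge_params tail head V lam \<tau>' \<mu>' \<nu>' e j. a' \<le> b'"
proof -
  define \<sigma> where "\<sigma> x = (if x = 0 then 0 else if x = 1 then 1
      else if card (lam e) = 2 then \<tau>' else if x = \<mu> then \<mu>' else \<nu>')" for x :: real
  have "\<sigma> x \<in> edge_params tail head V lam \<tau>' \<mu>' \<nu>' e k"
    if "x \<in> edge_params tail head V lam \<tau> \<mu> \<nu> e k" for x k
    using that assms(1,2) unfolding edge_params_def \<sigma>_def mem_Collect_eq
    by (elim disjE conjE) simp_all
  moreover have "\<sigma> a \<le> \<sigma> b"
  proof -
    have "x = 0 \<or> x = 1 \<or> x = \<tau> \<and> card (lam e) = 2 \<or> (x = \<mu> \<or> x = \<nu>) \<and> card (lam e) = 3"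
      if "x \<in> edge_params tail head V lam \<tau> \<mu> \<nu> e k" for x k
      using that unfolding edge_params_def by blast
    from this[OF assms(3)] this[OF assms(4)] assms(1,2,5) show ?thesis
      unfolding \<sigma>_def by (elim disjE conjE) simp_all
  qed
  ultimately show ?thesis using assms(3,4) by blast
qed

lemma edge_subset_edge_eq:
  assumes "polytope \<Omega>" "e edge_of \<Omega>" "e' edge_of \<Omega>" "x \<in> rel_interior e'" "x \<in> e"
  shows "e' = e"
proof -
  have e: "e face_of \<Omega>" "e' face_of \<Omega>" "aff_dim e = 1" "aff_dim e' = 1"
    using assms by (auto simp: edge_of_def)
  have "e' \<subseteq> e"
    using subset_of_face_of[OF e(1), of e'] assms face_of_imp_subset[OF e(2)] by auto
  then have "e' face_of e"
    using e face_of_face face_of_imp_subset by blast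
  moreover have "convex e" using e face_of_imp_convex by blast
  ultimately show ?thesis using face_of_aff_dim_lt[of e e'] e by auto
qed

lemma Vbar_Int_edge:
  assumes pol: "polytope \<Omega>" and or: "edge_orientation \<Omega> tail head"
    and gen: "generic_skeleton_cover \<Omega> tail head V lam t u v" and e: "e edge_of \<Omega>"
  obtains \<tau> \<mu> \<nu> where
    "card (lam e) = 2 \<Longrightarrow> 0 < \<tau> \<and> \<tau> < 1" "card (lam e) = 3 \<Longrightarrow> 0 < \<mu> \<and> \<mu> < \<nu> \<and> \<nu> < 1"
    "\<And>i. i \<in> {1,2,3} \<Longrightarrow>
      Vbar \<Omega> tail head V lam t u v i \<inter> e = edge_point tail head e ` edge_params tail head V lam \<tau> \<mu> \<nu> e i"
proof -
  let ?p = "edge_point tail head e"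
  note inj = edge_point_inj[OF or e]
  note ri = rel_interior_edge_eq_image[OF or e]
  have nice: "nice_skeleton_cover \<Omega> tail head V lam t u v"
    using gen by (simp add: generic_skeleton_cover_def)
  have "\<exists>\<tau>. card (lam e) = 2 \<longrightarrow> 0 < \<tau> \<and> \<tau> < 1 \<and> t e = ?p \<tau>"
    using gen e ri unfolding generic_skeleton_cover_def by fastforce
  then obtain \<tau> where \<tau>: "card (lam e) = 2 \<Longrightarrow> 0 < \<tau> \<and> \<tau> < 1 \<and> t e = ?p \<tau>" by blast
  have "\<exists>\<mu> \<nu>. 0 < \<mu> \<and> \<mu> < \<nu> \<and> \<nu> < 1 \<and> u e = ?p \<mu> \<and> v e = ?p \<nu>" if c: "card (lam e) = 3"
  proof -
    have "u e \<in> rel_interior e" "v e \<in> rel_interior e" "u e \<noteq> v e"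
      using gen e c unfolding generic_skeleton_cover_def by auto
    then obtain \<mu> \<nu> where m: "0 < \<mu>" "\<mu> < 1" "0 < \<nu>" "\<nu> < 1" "u e = ?p \<mu>" "v e = ?p \<nu>"
      using ri by auto
    have "u e \<in> closed_segment (tail e) (v e)"
      using nice e c unfolding nice_skeleton_cover_def by auto
    then obtain w where w: "0 \<le> w" "w \<le> 1" "u e = (1 - w) *\<^sub>R tail e + w *\<^sub>R v e"
      by (auto simp: in_segment)
    have "u e = ?p (w * \<nu>)" unfolding w(3) m(6) by (simp add: algebra_simps)
    then have "\<mu> = w * \<nu>" using inj m(5) by (metis injD)
    then have "\<mu> \<le> \<nu>" using w m by (simp add: mult_left_le_one_le)
    moreover have "\<mu> \<noteq> \<nu>" using m \<open>u e \<noteq> v e\<close> by auto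
    ultimately show ?thesis using m by force
  qed
  then obtain \<mu> \<nu> where mn: "card (lam e) = 3 \<Longrightarrow>
      0 < \<mu> \<and> \<mu> < \<nu> \<and> \<nu> < 1 \<and> u e = ?p \<mu> \<and> v e = ?p \<nu>" by blast
  have seg: "e = closed_segment (tail e) (head e)"
    using or e by (auto simp: edge_orientation_def)
  have efc: "e face_of \<Omega>" using e by (simp add: edge_of_def)
  have Ve: "x \<in> V i \<and> x \<in> e \<longleftrightarrow> x \<in> V i \<and> (x = ?p 0 \<or> x = ?p 1)" if "i \<in> {1,2,3}" for x i
  proof -
    have "x = tail e \<or> x = head e" if "x \<in> V i" "x \<in> e"
    proof -
      have "x extreme_point_of \<Omega>"
        using nice \<open>i \<in> _\<close> \<open>x \<in> V i\<close>
        unfolding nice_skeleton_cover_def vertex_edge_labelling_def vertices_def by blast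
      then have "x extreme_point_of e"
        using extreme_point_of_face[OF efc] that by simp
      then show ?thesis using seg extreme_point_of_segment by metis
    qed
    moreover have "tail e \<in> e" "head e \<in> e" using seg by (metis ends_in_segment)+
    ultimately show ?thesis by auto
  qed
  have other: "e' = e" if "e' edge_of \<Omega>" "x \<in> rel_interior e'" "x \<in> e" for e' x
    using edge_subset_edge_eq[OF pol e] that by blast
  have rit: "t e' \<in> rel_interior e'" if "e' edge_of \<Omega>" "card (lam e') = 2" for e'
    using gen that unfolding generic_skeleton_cover_def by blast
  have riuv: "u e' \<in> rel_interior e'" "v e' \<in> rel_interior e'"
    if "e' edge_of \<Omega>" "card (lam e') = 3" for e'
    using gen that unfolding generic_skeleton_cover_def by blast+
  have rsub: "rel_interior e \<subseteq> e" by (rule rel_interior_subset)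
  have "Vbar \<Omega> tail head V lam t u v i \<inter> e = ?p ` edge_params tail head V lam \<tau> \<mu> \<nu> e i"
    if i: "i \<in> {1,2,3}" for i
  proof -
    have "x \<in> Vbar \<Omega> tail head V lam t u v i \<and> x \<in> e \<longleftrightarrow>
       x \<in> V i \<and> x \<in> e \<or> x = t e \<and> i \<in> lam e \<and> card (lam e) = 2 \<or>
       x = u e \<and> card (lam e) = 3 \<and> (tail e \<in> V i \<or> head e \<notin> V i) \<or>
       x = v e \<and> card (lam e) = 3 \<and> (head e \<in> V i \<or> tail e \<notin> V i)" (is "_ \<longleftrightarrow> ?R x") for x
    proof
      have o2: "e' = e" if "e' edge_of \<Omega>" "card (lam e') = 2" "t e' \<in> e" for e'
        using other rit that by blast
      have o3: "e' = e" if "e' edge_of \<Omega>" "card (lam e') = 3" "u e' \<in> e \<or> v e' \<in> e" for e'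
        using other riuv that by blast
      assume "x \<in> Vbar \<Omega> tail head V lam t u v i \<and> x \<in> e"
      then show "?R x" unfolding Vbar_def by (auto dest: o2 o3)
    next
      assume "?R x"
      then show "x \<in> Vbar \<Omega> tail head V lam t u v i \<and> x \<in> e"
        unfolding Vbar_def using e rit[OF e] riuv[OF e] rsub by auto
    qed
    moreover have "x \<in> ?p ` edge_params tail head V lam \<tau> \<mu> \<nu> e i \<longleftrightarrow>
        x = ?p 0 \<and> tail e \<in> V i \<or> x = ?p 1 \<and> head e \<in> V i \<or>
        x = ?p \<tau> \<and> i \<in> lam e \<and> card (lam e) = 2 \<or>
        x = ?p \<mu> \<and> card (lam e) = 3 \<and> (tail e \<in> V i \<or> head e \<notin> V i) \<or>
        x = ?p \<nu> \<and> card (lam e) = 3 \<and> (head e \<in> V i \<or> tail e \<notin> V i)" for x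
      unfolding edge_params_def by blast
    moreover have "x \<in> V i \<and> x \<in> e \<longleftrightarrow>
        x = ?p 0 \<and> tail e \<in> V i \<or> x = ?p 1 \<and> head e \<in> V i" for x
      unfolding Ve[OF i, of x] by auto
    moreover have teq: "x = t e \<and> i \<in> lam e \<and> card (lam e) = 2 \<longleftrightarrow>
        x = ?p \<tau> \<and> i \<in> lam e \<and> card (lam e) = 2" for x
      using \<tau> by metis
    moreover have ueq: "x = u e \<and> card (lam e) = 3 \<and> P \<longleftrightarrow> x = ?p \<mu> \<and> card (lam e) = 3 \<and> P" for x P
      using mn by metis
    moreover have veq: "x = v e \<and> card (lam e) = 3 \<and> P \<longleftrightarrow> x = ?p \<nu> \<and> card (lam e) = 3 \<and> P" for x P
      using mn by metis
    ultimately have "x \<in> Vbar \<Omega> tail head V lam t u v i \<inter> e \<longleftrightarrow>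
        x \<in> ?p ` edge_params tail head V lam \<tau> \<mu> \<nu> e i" for x
      using teq ueq veq by (simp only: Int_iff disj_assoc)
    then show ?thesis by blast
  qed
  then show thesis using that[of \<tau> \<mu> \<nu>] \<tau> mn by blast
qed

lemma convex_hull_Int_face:
  fixes S :: "'a::euclidean_space set"
  assumes "compact S" "S \<subseteq> T" "convex T" "e face_of T"
  shows "convex hull S \<inter> e = convex hull (S \<inter> e)"
proof
  have sub: "convex hull S \<subseteq> T" using assms by (simp add: hull_minimal)
  have "(e \<inter> convex hull S) face_of (T \<inter> convex hull S)"
    using assms by (intro face_of_slice) auto
  then have "(convex hull S \<inter> e) face_of convex hull S"
    using sub by (simp add: Int_commute inf.absorb2)
  then obtain S' where "S' \<subseteq> S" "convex hull S \<inter> e = convex hull S'"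
    using face_of_convex_hull_subset[OF assms(1)] by metis
  moreover then have "S' \<subseteq> S \<inter> e" by (metis hull_subset le_inf_iff)
  ultimately show "convex hull S \<inter> e \<subseteq> convex hull (S \<inter> e)" by (simp add: hull_mono)
  show "convex hull (S \<inter> e) \<subseteq> convex hull S \<inter> e"
    using assms face_of_imp_convex[of e T] by (simp add: hull_mono hull_minimal)
qed

lemma hulls_meet_on_edge:
  assumes pol: "polytope \<Omega>" and or: "edge_orientation \<Omega> tail head"
    and gen: "generic_skeleton_cover \<Omega> tail head V lam t u v"
    and gen': "generic_skeleton_cover \<Omega> tail head V lam t' u' v'"
    and e: "e edge_of \<Omega>" and ij: "i \<in> {1,2,3}" "j \<in> {1,2,3}"
    and meet: "convex hull Vbar \<Omega> tail head V lam t u v i \<inter> convex hull Vbar \<Omega> tail head V lam t u v j \<inter> e \<noteq> {}"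
  shows "convex hull Vbar \<Omega> tail head V lam t' u' v' i \<inter> convex hull Vbar \<Omega> tail head V lam t' u' v' j \<inter> e \<noteq> {}"
proof -
  let ?p = "edge_point tail head e"
  have efc: "e face_of \<Omega>" using e by (simp add: edge_of_def)
  have fin: "finite {e. e edge_of \<Omega>}"
    by (rule finite_subset[OF _ finite_polytope_faces[OF pol]]) (auto simp: edge_of_def)
  have slice: "convex hull Vbar \<Omega> tail head V lam t u v i \<inter> e = convex hull (Vbar \<Omega> tail head V lam t u v i \<inter> e)"
    if gen: "generic_skeleton_cover \<Omega> tail head V lam t u v" and i: "i \<in> {1,2,3}" for t u v i
  proof (rule convex_hull_Int_face[OF _ _ polytope_imp_convex[OF pol] efc])
    have nice: "nice_skeleton_cover \<Omega> tail head V lam t u v"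
      using gen by (simp add: generic_skeleton_cover_def)
    have V: "V i \<subseteq> {x. x extreme_point_of \<Omega>}"
      using nice i
      unfolding nice_skeleton_cover_def vertex_edge_labelling_def vertices_def by blast
    have "finite {x. x extreme_point_of \<Omega>}"
      by (rule finite_polyhedron_extreme_points[OF polytope_imp_polyhedron[OF pol]])
    then have "finite (V i)" using V finite_subset by blast
    moreover have "Vbar \<Omega> tail head V lam t u v i \<subseteq>
        V i \<union> t ` {e. e edge_of \<Omega>} \<union> u ` {e. e edge_of \<Omega>} \<union> v ` {e. e edge_of \<Omega>}"
      unfolding Vbar_def by auto
    ultimately have "finite (Vbar \<Omega> tail head V lam t u v i)"
      using fin by (meson finite_UnI finite_imageI finite_subset)
    then show "compact (Vbar \<Omega> tail head V lam t u v i)" by (rule finite_imp_compact)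
    have "t e \<in> \<Omega>" if "e edge_of \<Omega>" "card (lam e) = 2" for e
      using nice that edge_of_imp_subset unfolding nice_skeleton_cover_def by blast
    moreover have "u e \<in> \<Omega>" "v e \<in> \<Omega>" if "e edge_of \<Omega>" "card (lam e) = 3" for e
      using nice that edge_of_imp_subset unfolding nice_skeleton_cover_def by blast+
    ultimately show "Vbar \<Omega> tail head V lam t u v i \<subseteq> \<Omega>"
      using V unfolding Vbar_def extreme_point_of_def by auto
  qed
  have hull: "convex hull (?p ` S) = ?p ` (convex hull S)" for S
  proof -
    have "?p ` S = (+) (tail e) ` ((\<lambda>s. s *\<^sub>R (head e - tail e)) ` S)" for S
      by (simp add: image_image)
    moreover have "convex hull ((\<lambda>s. s *\<^sub>R (head e - tail e)) ` S) = (\<lambda>s. s *\<^sub>R (head e - tail e)) ` (convex hull S)"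
      by (rule convex_hull_linear_image[symmetric]) (simp add: linear_scaleR_left)
    ultimately show ?thesis by (simp add: convex_hull_translation)
  qed
  note inj = edge_point_inj[OF or e]
  obtain \<tau> \<mu> \<nu> where p:
    "card (lam e) = 2 \<Longrightarrow> 0 < \<tau> \<and> \<tau> < 1" "card (lam e) = 3 \<Longrightarrow> 0 < \<mu> \<and> \<mu> < \<nu> \<and> \<nu> < 1"
    "\<And>i. i \<in> {1,2,3} \<Longrightarrow>
      Vbar \<Omega> tail head V lam t u v i \<inter> e = ?p ` edge_params tail head V lam \<tau> \<mu> \<nu> e i"
    using Vbar_Int_edge[OF pol or gen e] by blast
  obtain \<tau>' \<mu>' \<nu>' where p':
    "card (lam e) = 2 \<Longrightarrow> 0 < \<tau>' \<and> \<tau>' < 1" "card (lam e) = 3 \<Longrightarrow> 0 < \<mu>' \<and> \<mu>' < \<nu>' \<and> \<nu>' < 1"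
    "\<And>i. i \<in> {1,2,3} \<Longrightarrow>
      Vbar \<Omega> tail head V lam t' u' v' i \<inter> e = ?p ` edge_params tail head V lam \<tau>' \<mu>' \<nu>' e i"
    using Vbar_Int_edge[OF pol or gen' e] by blast
  let ?S = "edge_params tail head V lam \<tau> \<mu> \<nu> e" and ?S' = "edge_params tail head V lam \<tau>' \<mu>' \<nu>' e"
  have split: "A \<inter> B \<inter> e = (A \<inter> e) \<inter> (B \<inter> e)" for A B by blast
  have "convex hull Vbar \<Omega> tail head V lam t u v i \<inter> convex hull Vbar \<Omega> tail head V lam t u v j \<inter> e
      = ?p ` (convex hull ?S i \<inter> convex hull ?S j)"
    by (simp only: split[of "convex hull Vbar \<Omega> tail head V lam t u v i"] slice[OF gen ij(1)]
        slice[OF gen ij(2)] p(3)[OF ij(1)] p(3)[OF ij(2)] hull image_Int[OF inj])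
  then have "convex hull ?S i \<inter> convex hull ?S j \<noteq> {}" using meet by auto
  then obtain a1 b1 a2 b2 where "a1 \<in> ?S i" "b1 \<in> ?S j" "a1 \<le> b1" "a2 \<in> ?S i" "b2 \<in> ?S j" "b2 \<le> a2"
    unfolding real_hulls_meet_iff by blast
  then have "\<exists>a\<in>?S' i. \<exists>b\<in>?S' j. a \<le> b" "\<exists>b\<in>?S' j. \<exists>a\<in>?S' i. b \<le> a"
    using edge_params_meet_mono[of lam e \<tau> \<tau>' \<mu> \<nu> \<mu>' \<nu>' a1 tail head V i b1 j]
      edge_params_meet_mono[of lam e \<tau> \<tau>' \<mu> \<nu> \<mu>' \<nu>' b2 tail head V j a2 i] p(1,2) p'(1,2)
    by blast+
  then have "convex hull ?S' i \<inter> convex hull ?S' j \<noteq> {}"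
    unfolding real_hulls_meet_iff by blast
  moreover have "convex hull Vbar \<Omega> tail head V lam t' u' v' i \<inter> convex hull Vbar \<Omega> tail head V lam t' u' v' j \<inter> e
      = ?p ` (convex hull ?S' i \<inter> convex hull ?S' j)"
    by (simp only: split[of "convex hull Vbar \<Omega> tail head V lam t' u' v' i"] slice[OF gen' ij(1)]
        slice[OF gen' ij(2)] p'(3)[OF ij(1)] p'(3)[OF ij(2)] hull image_Int[OF inj])
  ultimately show ?thesis by auto
qed

lemma rel_frontier_two_face:
  assumes "polytope \<Omega>" "f face_of \<Omega>" "aff_dim f = 2"
  shows "rel_frontier f = \<Union>{e. e edge_of \<Omega> \<and> e \<subseteq> f}"
proof -
  have "polytope f" using assms face_of_polytope_polytope by blast
  then have pf: "polyhedron f" "closed f" by (simp_all add: polytope_imp_polyhedron polytope_imp_closed)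
  have "rel_frontier f = f - rel_interior f" using pf by (simp add: rel_frontier_def)
  also have "\<dots> = \<Union>{e. e facet_of f}" by (rule rel_boundary_of_polyhedron[OF pf(1)])
  also have "{e. e facet_of f} = {e. e edge_of \<Omega> \<and> e \<subseteq> f}"
    using assms unfolding facet_of_def edge_of_def
    by (auto dest: face_of_imp_subset face_of_trans face_of_face)
  finally show ?thesis .
qed

lemma labelling_faces_eq:
  assumes pol: "polytope \<Omega>" and or: "edge_orientation \<Omega> tail head"
    and gen: "generic_skeleton_cover \<Omega> tail head V lam t u v"
  shows "labelling_faces \<Omega> tail head V lam =
    faces_pairwise_meeting \<Omega> (\<lambda>i. convex hull (Vbar \<Omega> tail head V lam t u v i))"
proof -
  have "f \<in> faces_pairwise_meeting \<Omega> (\<lambda>i. convex hull (Vbar \<Omega> tail head V lam t u v i))"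
    if gen': "generic_skeleton_cover \<Omega> tail head V lam t' u' v'"
      and f: "f \<in> faces_pairwise_meeting \<Omega> (\<lambda>i. convex hull (Vbar \<Omega> tail head V lam t' u' v' i))" for f t' u' v'
  proof -
    have ff: "f face_of \<Omega>" "aff_dim f = 2" using f by (auto simp: faces_pairwise_meeting_def)
    note rf = rel_frontier_two_face[OF pol ff]
    have "convex hull Vbar \<Omega> tail head V lam t u v i \<inter> convex hull Vbar \<Omega> tail head V lam t u v j \<inter> rel_frontier f \<noteq> {}"
      if ij: "i \<in> {1,2,3}" "j \<in> {1,2,3}" "i \<noteq> j" for i j
    proof -
      have "convex hull Vbar \<Omega> tail head V lam t' u' v' i \<inter> convex hull Vbar \<Omega> tail head V lam t' u' v' j \<inter> rel_frontier f \<noteq> {}"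
        using f ij unfolding faces_pairwise_meeting_def by blast
      then obtain e where e: "e edge_of \<Omega>" "e \<subseteq> f"
        "convex hull Vbar \<Omega> tail head V lam t' u' v' i \<inter> convex hull Vbar \<Omega> tail head V lam t' u' v' j \<inter> e \<noteq> {}"
        unfolding rf by blast
      show ?thesis
        using hulls_meet_on_edge[OF pol or gen' gen e(1) ij(1,2) e(3)] e(1,2) unfolding rf by blast
    qed
    then show ?thesis using ff unfolding faces_pairwise_meeting_def by blast
  qed
  then show ?thesis using gen unfolding labelling_faces_def by blast
qed

end

theory Submission
  imports Defs
begin

text \<open>Three compact convex sets that meet pairwise and have a convex union have a common point: a
  hyperplane strictly separating the third set from the intersection of the first two would cut
  the union in a connected set covered by two disjoint nonempty closed pieces. Applied to the sets
  \<open>\<Omega>s i \<inter> f\<close>, this shows that any nice cover with \<open>Vbar i \<subseteq> \<Omega>s i\<close> will do: moving the points of a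
  generic cover to those of the given one is weakly monotone along each edge, so hulls of the generic
  cover that meet on an edge force the corresponding \<open>\<Omega>s i\<close> to meet there. To get such a cover,
  take all vertices in \<open>\<Omega>s i\<close> for \<open>V i\<close> and give each edge the smallest label possible; an edge
  needs three labels only when the sets at its two ends are disjoint on it, and then the third set
  fills the gap between them.\<close>

section \<open>Convexity tools: the Berge-Klee intersection theorem for three sets, and the gap
  between two intervals\<close>

lemma three_convex_common_point:
  fixes A B C :: "'a::euclidean_space set"
  assumes "compact A" "compact B" "compact C" "convex A" "convex B" "convex C"
    and conv: "convex (A \<union> B \<union> C)"
    and meet: "A \<inter> B \<noteq> {}" "A \<inter> C \<noteq> {}" "B \<inter> C \<noteq> {}"
  shows "A \<inter> B \<inter> C \<noteq> {}"
proof
  assume "A \<inter> B \<inter> C = {}"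
  then have "\<exists>a b. (\<forall>x\<in>A \<inter> B. a \<bullet> x < b) \<and> (\<forall>x\<in>C. a \<bullet> x > b)"
    using assms
    by (intro separating_hyperplane_compact_closed)
      (auto simp: compact_Int convex_Int compact_imp_closed)
  then obtain a b where lt: "\<And>x. x \<in> A \<inter> B \<Longrightarrow> a \<bullet> x < b" and gt: "\<And>x. x \<in> C \<Longrightarrow> a \<bullet> x > b"
    by blast
  define H where "H = {x. a \<bullet> x = b}"
  have H: "S \<inter> H \<noteq> {}" if "convex S" "p \<in> S" "q \<in> S" "a \<bullet> p < b" "b < a \<bullet> q" for S p q
    using connected_ivt_hyperplane[of S p q a b] that convex_connected unfolding H_def by force
  \<comment> \<open>\<open>A\<close> contains a point of \<open>A \<inter> B\<close>, strictly below
    \<open>H\<close>, and a point of \<open>A \<inter> C\<close>, strictly above it; being convex,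
    it crosses \<open>H\<close>. The same holds for \<open>B\<close>.\<close>
  have "A \<inter> H \<noteq> {}" "B \<inter> H \<noteq> {}"
    using meet lt gt H[of A] H[of B] assms by blast+
  moreover have "connected ((A \<union> B \<union> C) \<inter> H)"
    unfolding H_def by (intro convex_connected convex_Int conv convex_hyperplane)
  moreover have "(A \<union> B \<union> C) \<inter> H \<subseteq> A \<union> B" "A \<inter> B \<inter> ((A \<union> B \<union> C) \<inter> H) = {}"
    using lt gt unfolding H_def by fastforce+
  ultimately show False
    using assms(1,2)[THEN compact_imp_closed] unfolding connected_closed by blast
qed

text \<open>With \<open>\<mu>\<close> the last parameter of \<open>A\<close> and
  \<open>\<nu>\<close> the first one of \<open>B\<close>, only \<open>C\<close> can cover what lies
  strictly between them, and being closed it contains both ends as well.\<close>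

lemma fill_gap_unit_interval:
  fixes A B C :: "real set"
  assumes "closed A" "closed B" "closed C" "convex A" "convex B"
    and cov: "{0..1} \<subseteq> A \<union> B \<union> C" and "0 \<in> A" "1 \<in> B" and disj: "A \<inter> B \<inter> {0..1} = {}"
  obtains \<mu> \<nu> where "0 \<le> \<mu>" "\<mu> \<le> \<nu>" "\<nu> \<le> 1" "\<mu> \<in> A" "\<mu> \<in> C" "\<nu> \<in> B" "\<nu> \<in> C"
proof -
  have cpt: "compact (A \<inter> {0..1})" "compact (B \<inter> {0..1})"
    using assms by (auto intro: closed_Int_compact)
  obtain \<mu> where mu: "\<mu> \<in> A" "0 \<le> \<mu>" "\<mu> \<le> 1" "\<And>s. s \<in> A \<Longrightarrow> 0 \<le> s \<Longrightarrow> s \<le> 1 \<Longrightarrow> s \<le> \<mu>"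
    using compact_attains_sup[OF cpt(1)] \<open>0 \<in> A\<close> by fastforce
  obtain \<nu> where nu: "\<nu> \<in> B" "0 \<le> \<nu>" "\<nu> \<le> 1" "\<And>s. s \<in> B \<Longrightarrow> 0 \<le> s \<Longrightarrow> s \<le> 1 \<Longrightarrow> \<nu> \<le> s"
    using compact_attains_inf[OF cpt(2)] \<open>1 \<in> B\<close> by fastforce
  \<comment> \<open>Otherwise \<open>\<nu>\<close> would lie between 0 and \<open>\<mu>\<close>,
    hence in \<open>A\<close> by convexity, against \<open>disj\<close>.\<close>
  have "\<mu> < \<nu>"
  proof (rule ccontr)
    assume "\<not> \<mu> < \<nu>"
    moreover have "closed_segment 0 \<mu> \<subseteq> A"
      using closed_segment_subset[OF \<open>0 \<in> A\<close> mu(1) \<open>convex A\<close>] .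
    ultimately have "\<nu> \<in> A" using nu mu by (auto simp: closed_segment_eq_real_ivl)
    then show False using disj nu by auto
  qed
  have "{\<mu><..<\<nu>} \<subseteq> C"
  proof
    fix s assume "s \<in> {\<mu><..<\<nu>}"
    then have s: "\<mu> < s" "s < \<nu>" "0 \<le> s" "s \<le> 1" using mu nu by auto
    then have "s \<notin> A" "s \<notin> B" using mu(4)[of s] nu(4)[of s] by auto
    then show "s \<in> C" using cov s by auto
  qed
  \<comment> \<open>By strictness of \<open>\<mu> < \<nu>\<close> the open interval is nonempty, so
    its closure is the whole closed interval.\<close>
  then have "{\<mu>..\<nu>} \<subseteq> C"
    using closure_minimal[OF _ \<open>closed C\<close>, of "{\<mu><..<\<nu>}"] \<open>\<mu> < \<nu>\<close> by simp
  then show thesis using that[of \<mu> \<nu>] mu(1,2) nu(1,3) \<open>\<mu> < \<nu>\<close> by (auto simp: subset_iff)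
qed

section \<open>Transfer from a generic cover to an arbitrary nice cover\<close>

text \<open>Variant of \<open>edge_params_meet_mono\<close> for a target cover whose points may
  coincide with each other or with endpoints. Only the weak inequality \<open>a \<le> b\<close> has
  to survive, so collapsing parameters does no harm.\<close>

lemma edge_params_meet_mono_degenerate:
  assumes "card (lam e) = 2 \<Longrightarrow> 0 < \<tau> \<and> \<tau> < 1 \<and> 0 \<le> \<tau>' \<and> \<tau>' \<le> 1"
    and "card (lam e) = 3 \<Longrightarrow> 0 < \<mu> \<and> \<mu> < \<nu> \<and> \<nu> < 1 \<and> 0 \<le> \<mu>' \<and> \<mu>' \<le> \<nu>' \<and> \<nu>' \<le> 1"
    and "a \<in> edge_params tail head V lam \<tau> \<mu> \<nu> e i" "b \<in> edge_params tail head V lam \<tau> \<mu> \<nu> e j" "a \<le> b"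
  shows "\<exists>a'\<in>edge_params tail head V lam \<tau>' \<mu>' \<nu>' e i.
    \<exists>b'\<in>edge_params tail head V lam \<tau>' \<mu>' \<nu>' e j. a' \<le> b'"
proof -
  \<comment> \<open>\<open>\<sigma>\<close> sends each generic parameter to the one with the same
    role in the target cover. This is unambiguous because generic parameters are distinct; of those
    in use, only \<open>\<nu>\<close> reaches the last branch.\<close>
  define \<sigma> where "\<sigma> x = (if x = 0 then 0 else if x = 1 then 1
      else if card (lam e) = 2 then \<tau>' else if x = \<mu> then \<mu>' else \<nu>')" for x :: real
  have "\<sigma> x \<in> edge_params tail head V lam \<tau>' \<mu>' \<nu>' e k"
    if "x \<in> edge_params tail head V lam \<tau> \<mu> \<nu> e k" for x k
    using that assms(1,2) unfolding edge_params_def \<sigma>_def mem_Collect_eq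
    by (elim disjE conjE) simp_all
  moreover have "\<sigma> a \<le> \<sigma> b"
  proof -
    have "x = 0 \<or> x = 1 \<or> x = \<tau> \<and> card (lam e) = 2 \<or> (x = \<mu> \<or> x = \<nu>) \<and> card (lam e) = 3"
      if "x \<in> edge_params tail head V lam \<tau> \<mu> \<nu> e k" for x k
      using that unfolding edge_params_def by blast
    from this[OF assms(3)] this[OF assms(4)] assms(1,2,5) show ?thesis
      unfolding \<sigma>_def by (elim disjE conjE) simp_all
  qed
  ultimately show ?thesis using assms(3,4) by blast
qed

text \<open>Unlike in \<open>Vbar_Int_edge\<close>, only an inclusion holds: without genericity, a
  point chosen on another edge may be an endpoint of \<open>e\<close>. The inclusion is what lets
  any superset of \<open>Vbar\<close> inherit the points with these parameters.\<close>

lemma edge_params_image_subset_Vbar: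
  assumes or: "edge_orientation \<Omega> tail head"
    and nice: "nice_skeleton_cover \<Omega> tail head V lam t u v" and e: "e edge_of \<Omega>"
  obtains \<tau> \<mu> \<nu> where
    "card (lam e) = 2 \<Longrightarrow> 0 \<le> \<tau> \<and> \<tau> \<le> 1" "card (lam e) = 3 \<Longrightarrow> 0 \<le> \<mu> \<and> \<mu> \<le> \<nu> \<and> \<nu> \<le> 1"
    "\<And>i. edge_point tail head e ` edge_params tail head V lam \<tau> \<mu> \<nu> e i
      \<subseteq> Vbar \<Omega> tail head V lam t u v i"
proof -
  let ?p = "edge_point tail head e"
  note inj = edge_point_inj[OF or e]
  have img: "\<exists>s. 0 \<le> s \<and> s \<le> 1 \<and> x = ?p s" if "x \<in> e" for x
    using that edge_eq_image[OF or e] by fastforce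
  have "\<exists>\<tau>. card (lam e) = 2 \<longrightarrow> 0 \<le> \<tau> \<and> \<tau> \<le> 1 \<and> t e = ?p \<tau>"
    using nice e img unfolding nice_skeleton_cover_def by metis
  then obtain \<tau> where \<tau>: "card (lam e) = 2 \<Longrightarrow> 0 \<le> \<tau> \<and> \<tau> \<le> 1 \<and> t e = ?p \<tau>" by blast
  have "\<exists>\<mu> \<nu>. 0 \<le> \<mu> \<and> \<mu> \<le> \<nu> \<and> \<nu> \<le> 1 \<and> u e = ?p \<mu> \<and> v e = ?p \<nu>" if c: "card (lam e) = 3"
  proof -
    have uv: "u e \<in> e" "v e \<in> e" "u e \<in> closed_segment (tail e) (v e)"
      using nice e c unfolding nice_skeleton_cover_def by auto
    obtain \<nu> where n: "0 \<le> \<nu>" "\<nu> \<le> 1" "v e = ?p \<nu>" using img[OF uv(2)] by blast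
    obtain w where w: "0 \<le> w" "w \<le> 1" "u e = (1 - w) *\<^sub>R tail e + w *\<^sub>R v e"
      using uv(3) by (auto simp: in_segment)
    \<comment> \<open>Since \<open>u e\<close> lies between the tail and \<open>v e\<close>, scaling
      \<open>\<nu>\<close> by \<open>w\<close> yields a parameter of \<open>u e\<close> that is
      automatically at most \<open>\<nu>\<close>.\<close>
    have "u e = ?p (w * \<nu>)" unfolding w(3) n(3) by (simp add: algebra_simps)
    moreover have "0 \<le> w * \<nu>" "w * \<nu> \<le> \<nu>" using w n by (simp_all add: mult_left_le_one_le)
    ultimately show ?thesis using n by blast
  qed
  then obtain \<mu> \<nu> where mn: "card (lam e) = 3 \<Longrightarrow>
      0 \<le> \<mu> \<and> \<mu> \<le> \<nu> \<and> \<nu> \<le> 1 \<and> u e = ?p \<mu> \<and> v e = ?p \<nu>" by blast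
  have "?p s \<in> Vbar \<Omega> tail head V lam t u v i"
    if s: "s \<in> edge_params tail head V lam \<tau> \<mu> \<nu> e i" for s i
  proof -
    consider "s = 0" "tail e \<in> V i" | "s = 1" "head e \<in> V i"
      | "s = \<tau>" "i \<in> lam e" "card (lam e) = 2"
      | "s = \<mu>" "card (lam e) = 3" "tail e \<in> V i \<or> head e \<notin> V i"
      | "s = \<nu>" "card (lam e) = 3" "head e \<in> V i \<or> tail e \<notin> V i"
      using s unfolding edge_params_def by blast
    then show ?thesis
    proof cases
      case 3
      then have "?p s = t e" using \<tau> by simp
      then show ?thesis using 3 e unfolding Vbar_def by blast
    next
      case 4
      then have "?p s = u e" using mn by simp
      then show ?thesis using 4 e unfolding Vbar_def by blast
    next
      case 5
      then have "?p s = v e" using mn by simp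
      then show ?thesis using 5 e unfolding Vbar_def by blast
    qed (auto simp: Vbar_def)
  qed
  then show thesis using that[of \<tau> \<mu> \<nu>] \<tau> mn by blast
qed

lemma vertices_subset: "vertices \<Omega> \<subseteq> \<Omega>"
  by (auto simp: vertices_def extreme_point_of_def)

lemma nice_skeleton_cover_V_subset:
  assumes "nice_skeleton_cover \<Omega> tail head V lam t u v" "i \<in> {1,2,3}"
  shows "V i \<subseteq> vertices \<Omega>"
  using assms unfolding nice_skeleton_cover_def vertex_edge_labelling_def by blast

lemma nice_skeleton_cover_Vbar_subset:
  assumes nice: "nice_skeleton_cover \<Omega> tail head V lam t u v" and i: "i \<in> {1,2,3}"
  shows "Vbar \<Omega> tail head V lam t u v i \<subseteq> \<Omega>"
proof -
  have "t e \<in> \<Omega>" if "e edge_of \<Omega>" "card (lam e) = 2" for e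
    using nice that edge_of_imp_subset unfolding nice_skeleton_cover_def by blast
  moreover have "u e \<in> \<Omega>" "v e \<in> \<Omega>" if "e edge_of \<Omega>" "card (lam e) = 3" for e
    using nice that edge_of_imp_subset unfolding nice_skeleton_cover_def by blast+
  ultimately show ?thesis
    using nice_skeleton_cover_V_subset[OF nice i] vertices_subset[of \<Omega>] unfolding Vbar_def by blast
qed

lemma nice_skeleton_cover_finite_Vbar:
  assumes pol: "polytope \<Omega>"
    and nice: "nice_skeleton_cover \<Omega> tail head V lam t u v" and i: "i \<in> {1,2,3}"
  shows "finite (Vbar \<Omega> tail head V lam t u v i)"
proof -
  have "finite {e. e edge_of \<Omega>}"
    by (rule finite_subset[OF _ finite_polytope_faces[OF pol]]) (auto simp: edge_of_def)
  moreover have "finite (V i)"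
    using finite_subset[OF nice_skeleton_cover_V_subset[OF nice i]]
      finite_polyhedron_extreme_points[OF polytope_imp_polyhedron[OF pol]]
    by (simp add: vertices_def)
  moreover have "Vbar \<Omega> tail head V lam t u v i \<subseteq>
      V i \<union> t ` {e. e edge_of \<Omega>} \<union> u ` {e. e edge_of \<Omega>} \<union> v ` {e. e edge_of \<Omega>}"
    unfolding Vbar_def by auto
  ultimately show ?thesis by (meson finite_UnI finite_imageI finite_subset)
qed

lemma hull_edge_point_image:
  "convex hull (edge_point tail head e ` S) = edge_point tail head e ` (convex hull S)"
proof -
  have *: "edge_point tail head e ` S = (+) (tail e) ` ((\<lambda>s. s *\<^sub>R (head e - tail e)) ` S)" for S
    by (simp add: image_image)
  have "convex hull ((\<lambda>s. s *\<^sub>R (head e - tail e)) ` S) = (\<lambda>s. s *\<^sub>R (head e - tail e)) ` (convex hull S)"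
    by (rule convex_hull_linear_image[symmetric]) (simp add: linear_scaleR_left)
  then show ?thesis unfolding * by (simp add: convex_hull_translation)
qed

text \<open>On a single edge, whether two hulls meet depends only on weak comparisons between
  parameters. These persist when the generic points are moved to the given ones, and convexity of
  \<open>A\<close> and \<open>B\<close> then supplies the common point.\<close>

lemma generic_hulls_meet_imp_supersets_meet:
  assumes pol: "polytope \<Omega>" and or: "edge_orientation \<Omega> tail head"
    and gen: "generic_skeleton_cover \<Omega> tail head V lam t u v"
    and nice': "nice_skeleton_cover \<Omega> tail head V lam t' u' v'"
    and e: "e edge_of \<Omega>" and ij: "i \<in> {1,2,3}" "j \<in> {1,2,3}"
    and meet: "convex hull Vbar \<Omega> tail head V lam t u v i \<inter> convex hull Vbar \<Omega> tail head V lam t u v j \<inter> e \<noteq> {}"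
    and AB: "convex A" "convex B"
      "Vbar \<Omega> tail head V lam t' u' v' i \<subseteq> A" "Vbar \<Omega> tail head V lam t' u' v' j \<subseteq> B"
  shows "A \<inter> B \<inter> e \<noteq> {}"
proof -
  let ?p = "edge_point tail head e"
  note inj = edge_point_inj[OF or e]
  have efc: "e face_of \<Omega>" using e by (simp add: edge_of_def)
  have nice: "nice_skeleton_cover \<Omega> tail head V lam t u v"
    using gen by (simp add: generic_skeleton_cover_def)
  obtain \<tau> \<mu> \<nu> where p:
    "card (lam e) = 2 \<Longrightarrow> 0 < \<tau> \<and> \<tau> < 1" "card (lam e) = 3 \<Longrightarrow> 0 < \<mu> \<and> \<mu> < \<nu> \<and> \<nu> < 1"
    "\<And>i. i \<in> {1,2,3} \<Longrightarrow>
      Vbar \<Omega> tail head V lam t u v i \<inter> e = ?p ` edge_params tail head V lam \<tau> \<mu> \<nu> e i"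
    using Vbar_Int_edge[OF pol or gen e] by blast
  obtain \<tau>' \<mu>' \<nu>' where p':
    "card (lam e) = 2 \<Longrightarrow> 0 \<le> \<tau>' \<and> \<tau>' \<le> 1" "card (lam e) = 3 \<Longrightarrow> 0 \<le> \<mu>' \<and> \<mu>' \<le> \<nu>' \<and> \<nu>' \<le> 1"
    "\<And>i. ?p ` edge_params tail head V lam \<tau>' \<mu>' \<nu>' e i \<subseteq> Vbar \<Omega> tail head V lam t' u' v' i"
    using edge_params_image_subset_Vbar[OF or nice' e] by blast
  let ?S = "edge_params tail head V lam \<tau> \<mu> \<nu> e" and ?S' = "edge_params tail head V lam \<tau>' \<mu>' \<nu>' e"
  \<comment> \<open>An edge is a face, so the hull meets it exactly in the hull of the points of
    \<open>Vbar\<close> on it; the question becomes one about hulls of sets of reals.\<close>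
  have slice: "convex hull Vbar \<Omega> tail head V lam t u v k \<inter> e = ?p ` (convex hull ?S k)"
    if k: "k \<in> {1,2,3}" for k
    using convex_hull_Int_face[OF finite_imp_compact nice_skeleton_cover_Vbar_subset[OF nice k]
        polytope_imp_convex[OF pol] efc] nice_skeleton_cover_finite_Vbar[OF pol nice k]
    by (simp add: p(3)[OF k] hull_edge_point_image)
  have "?p ` (convex hull ?S i \<inter> convex hull ?S j) \<noteq> {}"
    using meet unfolding image_Int[OF inj] slice[OF ij(1), symmetric] slice[OF ij(2), symmetric]
    by blast
  then have "convex hull ?S i \<inter> convex hull ?S j \<noteq> {}" by blast
  then obtain a1 b1 a2 b2 where "a1 \<in> ?S i" "b1 \<in> ?S j" "a1 \<le> b1" "a2 \<in> ?S i" "b2 \<in> ?S j" "b2 \<le> a2"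
    unfolding real_hulls_meet_iff by blast
  \<comment> \<open>The two comparisons demanded by \<open>real_hulls_meet_iff\<close> are
    transported separately, the second one with \<open>i\<close> and \<open>j\<close>
    exchanged.\<close>
  then have "\<exists>a\<in>?S' i. \<exists>b\<in>?S' j. a \<le> b" "\<exists>b\<in>?S' j. \<exists>a\<in>?S' i. b \<le> a"
    using edge_params_meet_mono_degenerate[of lam e \<tau> \<tau>' \<mu> \<nu> \<mu>' \<nu>' a1 tail head V i b1 j]
      edge_params_meet_mono_degenerate[of lam e \<tau> \<tau>' \<mu> \<nu> \<mu>' \<nu>' b2 tail head V j a2 i] p(1,2) p'(1,2)
    by blast+
  then obtain s where s: "s \<in> convex hull ?S' i" "s \<in> convex hull ?S' j"
    using real_hulls_meet_iff[of "?S' i" "?S' j"] by blast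
  have "?p s \<in> A"
    using s(1) hull_edge_point_image[of tail e head "?S' i"]
      hull_minimal[OF order_trans[OF p'(3) AB(3)], of convex] AB(1) by blast
  moreover have "?p s \<in> B"
    using s(2) hull_edge_point_image[of tail e head "?S' j"]
      hull_minimal[OF order_trans[OF p'(3) AB(4)], of convex] AB(2) by blast
  moreover have "?p s \<in> e"
  proof -
    have "?S' i \<subseteq> {0..1}" using p'(1,2) unfolding edge_params_def by auto
    then have "convex hull ?S' i \<subseteq> {0..1}" by (intro hull_minimal) auto
    then show ?thesis using s(1) edge_eq_image[OF or e] by blast
  qed
  ultimately show ?thesis by blast
qed

section \<open>Labelling a single edge\<close>

text \<open>In the last two lines, \<open>y \<in> W i \<longrightarrow> x \<in> W i\<close> merges the two cases of the definition of \<open>Vbar\<close>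
  in which \<open>u\<close> occurs: \<open>W i\<close> contains the tail \<open>x\<close>, or it contains no endpoint.\<close>

definition segment_labelling ::
    "(nat \<Rightarrow> 'a::euclidean_space set) \<Rightarrow> 'a \<Rightarrow> 'a \<Rightarrow> nat set \<Rightarrow> 'a \<Rightarrow> 'a \<Rightarrow> 'a \<Rightarrow> bool" where
  "segment_labelling W x y L t u v \<longleftrightarrow>
     L \<noteq> {} \<and> L \<subseteq> {1,2,3} \<and>
     (\<forall>i. L = {i} \<longrightarrow> x \<in> W i \<and> y \<in> W i) \<and>
     (\<forall>i j. i \<noteq> j \<and> L = {i,j} \<longrightarrow> x \<in> W i \<and> y \<in> W j \<or> y \<in> W i \<and> x \<in> W j) \<and>
     (L = {1,2,3} \<longrightarrow>
        (\<exists>i j k. {i,j,k} = {1,2,3} \<and> x \<in> W i \<and> y \<in> W j \<and> x \<notin> W k \<and> y \<notin> W k)) \<and>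
     (card L = 2 \<longrightarrow> t \<in> closed_segment x y \<and> (\<forall>i\<in>L. t \<in> W i)) \<and>
     (card L = 3 \<longrightarrow> u \<in> closed_segment x y \<and> v \<in> closed_segment x y \<and>
        u \<in> closed_segment x v \<and> v \<in> closed_segment u y \<and>
        (\<forall>i\<in>{1,2,3}. (y \<in> W i \<longrightarrow> x \<in> W i) \<longrightarrow> u \<in> W i) \<and>
        (\<forall>i\<in>{1,2,3}. (x \<in> W i \<longrightarrow> y \<in> W i) \<longrightarrow> v \<in> W i))"

text \<open>The cases follow the size of the label: one set contains both ends; or a set at
  \<open>x\<close> meets a set at \<open>y\<close> on the segment; or all such pairs are disjoint
  there, and the remaining set bridges the gap.\<close>

lemma segment_labelling_exists:
  fixes W :: "nat \<Rightarrow> 'a::euclidean_space set"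
  assumes W: "\<And>i. i \<in> {1,2,3} \<Longrightarrow> closed (W i) \<and> convex (W i)"
    and cov: "closed_segment x y \<subseteq> (\<Union>i\<in>{1,2,3}. W i)"
  shows "\<exists>L t u v. segment_labelling W x y L t u v"
proof (cases "\<exists>i\<in>{1,2,3}. x \<in> W i \<and> y \<in> W i")
  case True
  then obtain i where "i \<in> {1,2,3}" "x \<in> W i" "y \<in> W i" by (elim bexE conjE)
  \<comment> \<open>A one-element label puts no condition on the three points, so \<open>x\<close>
    serves as a placeholder.\<close>
  then have "segment_labelling W x y {i} x x x"
    unfolding segment_labelling_def by auto
  then show ?thesis by blast
next
  case False
  then have no_common: "x \<notin> W m \<or> y \<notin> W m" if "m \<in> {1,2,3}" for m
    using that by auto
  show ?thesis
  proof (cases "\<exists>i\<in>{1,2,3}. \<exists>j\<in>{1,2,3}. \<exists>t\<in>closed_segment x y.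
      x \<in> W i \<and> y \<in> W j \<and> t \<in> W i \<and> t \<in> W j")
    case True
    then obtain i j t where two: "i \<in> {1,2,3}" "j \<in> {1,2,3}" "t \<in> closed_segment x y"
        "x \<in> W i" "y \<in> W j" "t \<in> W i" "t \<in> W j"
      by (elim bexE conjE)
    then have "i \<noteq> j" using no_common[of i] by auto
    then have "card {i, j} = 2" by simp
    moreover from this have "{i, j} \<noteq> {1, 2, 3}" "{i, j} \<noteq> {a}" for a by auto
    \<comment> \<open>Here only \<open>t\<close>, the common point of the two sets, is
      constrained.\<close>
    ultimately have "segment_labelling W x y {i, j} t x x"
      using two unfolding segment_labelling_def by (auto simp: doubleton_eq_iff)
    then show ?thesis by blast
  next
    case False
    then have disj: "W l \<inter> W m \<inter> closed_segment x y = {}"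
      if "l \<in> {1,2,3}" "m \<in> {1,2,3}" "x \<in> W l" "y \<in> W m" for l m
      using that by (simp only: disjoint_iff Int_iff) metis
    have "x \<in> (\<Union>i\<in>{1,2,3}. W i)" "y \<in> (\<Union>i\<in>{1,2,3}. W i)"
      using subsetD[OF cov] ends_in_segment by auto
    then obtain i j where ij: "i \<in> {1,2,3}" "x \<in> W i" "j \<in> {1,2,3}" "y \<in> W j"
      by (elim UN_E)
    then have "i \<noteq> j" using no_common[of i] by auto
    \<comment> \<open>The third index is what remains of the sum 1 + 2 + 3 = 6.\<close>
    then have "{i,j,6-i-j} = {1,2,3}"
      using ij(1,3) by (elim insertE) auto
    then obtain k where k: "{i,j,k} = {1,2,3}" by metis
    then have k3: "k \<in> {1,2,3}" by (metis insertCI)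
    \<comment> \<open>Pulling the sets back along this parametrization turns them into closed convex
      sets of reals, as \<open>fill_gap_unit_interval\<close> requires.\<close>
    define p where "p s = x + s *\<^sub>R (y - x)" for s :: real
    have seg: "closed_segment x y = p ` {0..1}"
      unfolding p_def by (simp add: closed_segment_image_interval algebra_simps)
    have cont: "continuous_on UNIV p" unfolding p_def by (intro continuous_intros)
    have cl: "closed (p -` W m)" if "m \<in> {1,2,3}" for m
      using W[OF that] cont by (simp add: closed_vimage continuous_on_eq_continuous_at)
    have cv: "convex (p -` W m)" if "m \<in> {1,2,3}" for m
    proof -
      have "p -` W m = (\<lambda>s. s *\<^sub>R (y - x)) -` ((+) (- x) ` W m)"
        unfolding p_def by (force simp: image_iff)
      then show ?thesis
        using W[OF that] by (simp add: convex_linear_vimage linear_scaleR_left)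
    qed
    have "{0..1} \<subseteq> p -` W i \<union> p -` W j \<union> p -` W k"
    proof
      fix s :: real assume "s \<in> {0..1}"
      then have "p s \<in> (\<Union>m\<in>{i,j,k}. W m)" unfolding k using subsetD[OF cov] seg by simp
      then show "s \<in> p -` W i \<union> p -` W j \<union> p -` W k" by auto
    qed
    moreover have "p -` W i \<inter> p -` W j \<inter> {0..1} = {}"
      using disj[OF ij(1,3,2,4)] unfolding seg by blast
    moreover have "0 \<in> p -` W i" "1 \<in> p -` W j" using ij by (simp_all add: p_def)
    ultimately obtain \<mu> \<nu> where mn: "0 \<le> \<mu>" "\<mu> \<le> \<nu>" "\<nu> \<le> 1"
        "p \<mu> \<in> W i" "p \<mu> \<in> W k" "p \<nu> \<in> W j" "p \<nu> \<in> W k"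
      using fill_gap_unit_interval[OF cl[OF ij(1)] cl[OF ij(3)] cl[OF k3] cv[OF ij(1)] cv[OF ij(3)]]
      by (metis vimage_eq)
    have on: "p \<mu> \<in> closed_segment x y" "p \<nu> \<in> closed_segment x y" using mn seg by auto
    \<comment> \<open>If \<open>W k\<close> contained \<open>x\<close>, then \<open>disj\<close>
      would separate it from \<open>W j\<close> on the segment, yet \<open>p \<nu>\<close> is in
      both; if it contained \<open>y\<close>, then \<open>p \<mu>\<close> would give the same
      contradiction with \<open>W i\<close>.\<close>
    have nk: "x \<notin> W k" "y \<notin> W k"
      using disj[OF k3 ij(3) _ ij(4)] disj[OF ij(1) k3 ij(2)] mn on by blast+
    have nij: "y \<notin> W i" "x \<notin> W j" using no_common ij by auto
    have ord: "p \<mu> \<in> closed_segment x (p \<nu>)" "p \<nu> \<in> closed_segment (p \<mu>) y"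
    proof -
      have im: "p ` closed_segment a b = closed_segment (p a) (p b)" for a b
      proof -
        have *: "p ` S = (+) x ` ((\<lambda>s. s *\<^sub>R (y - x)) ` S)" for S
          unfolding p_def by (simp add: image_image)
        have "(\<lambda>s. s *\<^sub>R (y - x)) ` closed_segment a b
            = closed_segment (a *\<^sub>R (y - x)) (b *\<^sub>R (y - x))"
          by (rule closed_segment_linear_image[symmetric]) (simp add: linear_scaleR_left)
        then show ?thesis unfolding * by (simp add: p_def closed_segment_translation)
      qed
      have "p 0 = x" "p 1 = y" by (simp_all add: p_def)
      then show "p \<mu> \<in> closed_segment x (p \<nu>)" "p \<nu> \<in> closed_segment (p \<mu>) y"
        using im[of 0 \<nu>] im[of \<mu> 1] mn by (auto simp: closed_segment_eq_real_ivl)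
    qed
    have all3: "(\<forall>m\<in>{1,2,3}. Q m) \<longleftrightarrow> Q i \<and> Q j \<and> Q k" for Q
      unfolding k[symmetric] by simp
    have card3: "card {1,2,3::nat} = 3" by simp
    moreover have "{1,2,3} \<noteq> {a,b}" for a b :: nat
    proof
      assume "{1,2,3} = {a,b}"
      then have "card {a,b} = 3" using card3 by metis
      then show False using card_insert_le_m1[of 2 "{b}" a] by simp
    qed
    moreover from this have "{1,2,3} \<noteq> {a}" for a :: nat by (metis insert_absorb2)
    moreover have "\<exists>i j k. {i, j, k} = {1, 2, 3} \<and> x \<in> W i \<and> y \<in> W j \<and> x \<notin> W k \<and> y \<notin> W k"
      using k ij nk by blast
    \<comment> \<open>By \<open>nij\<close> and \<open>nk\<close>, the sets that must contain
      \<open>u\<close> are \<open>W i\<close> and \<open>W k\<close>, and those that must contain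
      \<open>v\<close> are \<open>W j\<close> and \<open>W k\<close>: exactly the memberships of
      \<open>p \<mu>\<close> and \<open>p \<nu>\<close>.\<close>
    ultimately have "segment_labelling W x y {1,2,3} x (p \<mu>) (p \<nu>)"
      unfolding segment_labelling_def all3 using mn on ord ij(2,4) nij by simp
    then show ?thesis by blast
  qed
qed

section \<open>Assembling the cover and finding common points on faces\<close>

theorem lemma3p6:
  fixes \<Omega> :: "'a::euclidean_space set" and tail head :: "'a set \<Rightarrow> 'a"
    and \<Omega>s :: "nat \<Rightarrow> 'a set"
  assumes "polytope \<Omega>"
    and "edge_orientation \<Omega> tail head"
    and "\<And>i. i \<in> {1,2,3} \<Longrightarrow> closed (\<Omega>s i) \<and> convex (\<Omega>s i)"
    and "\<Omega> \<subseteq> (\<Union>i\<in>{1,2,3}. \<Omega>s i)"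
  shows "\<exists>V lam t u v.
           nice_skeleton_cover \<Omega> tail head V lam t u v \<and>
           (\<forall>i\<in>{1,2,3}. Vbar \<Omega> tail head V lam t u v i \<subseteq> \<Omega>s i) \<and>
           (\<forall>f\<in>labelling_faces \<Omega> tail head V lam. \<Omega>s 1 \<inter> \<Omega>s 2 \<inter> \<Omega>s 3 \<inter> f \<noteq> {})"
proof -
  have "\<exists>V lam t u v. nice_skeleton_cover \<Omega> tail head V lam t u v \<and>
      (\<forall>i\<in>{1,2,3}. Vbar \<Omega> tail head V lam t u v i \<subseteq> \<Omega>s i)"
  proof -
    define V where "V i = vertices \<Omega> \<inter> \<Omega>s i" for i
    have seg: "closed_segment (tail e) (head e) = e" if "e edge_of \<Omega>" for e
      using assms(2) that unfolding edge_orientation_def by metis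
    \<comment> \<open>The conditions on different edges are independent once the sets at the
      vertices are fixed, so labels and points can be chosen edge by edge.\<close>
    have "\<exists>L t u v. segment_labelling \<Omega>s (tail e) (head e) L t u v" if "e edge_of \<Omega>" for e
      using order_trans[OF edge_of_imp_subset[OF that] assms(4)]
      by (intro segment_labelling_exists[OF assms(3)]) (simp_all only: seg[OF that])
    then obtain lam t u v where
      lab: "\<And>e. e edge_of \<Omega> \<Longrightarrow> segment_labelling \<Omega>s (tail e) (head e) (lam e) (t e) (u e) (v e)"
      by metis
    \<comment> \<open>Endpoints of an edge are extreme points of the polytope, so on them
      \<open>V i\<close> and \<open>\<Omega>s i\<close> agree. This translates the labelling by
      \<open>\<Omega>s\<close> into one by \<open>V\<close>.\<close>
    have Vend: "tail e \<in> V i \<longleftrightarrow> tail e \<in> \<Omega>s i" "head e \<in> V i \<longleftrightarrow> head e \<in> \<Omega>s i"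
      if "e edge_of \<Omega>" for e i
    proof -
      have "e face_of \<Omega>" using that by (simp add: edge_of_def)
      then have "tail e extreme_point_of \<Omega>" "head e extreme_point_of \<Omega>"
        using extreme_point_of_face extreme_point_of_segment[of _ "tail e" "head e"]
        unfolding seg[OF that] by blast+
      then show "tail e \<in> V i \<longleftrightarrow> tail e \<in> \<Omega>s i" "head e \<in> V i \<longleftrightarrow> head e \<in> \<Omega>s i"
        by (auto simp: V_def vertices_def)
    qed
    note lab' = lab[unfolded segment_labelling_def]
    have "(\<Union>i\<in>{1,2,3}. V i) = vertices \<Omega>"
      using assms(4) vertices_subset[of \<Omega>] by (auto simp: V_def)
    moreover have "\<forall>i\<in>{1,2,3}. V i \<subseteq> vertices \<Omega>" by (simp add: V_def)
    moreover have "lam e \<noteq> {}" "lam e \<subseteq> {1,2,3}"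
        "lam e = {i} \<Longrightarrow> tail e \<in> V i" "lam e = {i} \<Longrightarrow> head e \<in> V i"
        "i \<noteq> j \<and> lam e = {i,j} \<Longrightarrow>
          tail e \<in> V i \<and> head e \<in> V j \<or> head e \<in> V i \<and> tail e \<in> V j"
        "lam e = {1,2,3} \<Longrightarrow>
          \<exists>i j k. {i,j,k} = {1,2,3} \<and> tail e \<in> V i \<and> head e \<in> V j \<and>
            tail e \<notin> V k \<and> head e \<notin> V k" if "e edge_of \<Omega>" for e i j
      using lab'[OF that] unfolding Vend[OF that] by (elim conjE; metis)+
    ultimately have "vertex_edge_labelling \<Omega> tail head V lam"
      unfolding vertex_edge_labelling_def by (intro conjI allI impI)
    moreover have "t e \<in> e" if "e edge_of \<Omega>" "card (lam e) = 2" for e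
      using lab'[OF that(1)] that(2) unfolding seg[OF that(1)] by blast
    moreover have "u e \<in> e" "v e \<in> e" "u e \<in> closed_segment (tail e) (v e)"
        "v e \<in> closed_segment (u e) (head e)" if "e edge_of \<Omega>" "card (lam e) = 3" for e
      using lab'[OF that(1)] that(2) unfolding seg[OF that(1)] by blast+
    ultimately have "nice_skeleton_cover \<Omega> tail head V lam t u v"
      unfolding nice_skeleton_cover_def by metis
    moreover have "Vbar \<Omega> tail head V lam t u v i \<subseteq> \<Omega>s i" if i: "i \<in> {1,2,3}" for i
    proof -
      have "t e \<in> \<Omega>s i" if "e edge_of \<Omega>" "card (lam e) = 2" "i \<in> lam e" for e
        using lab'[OF that(1)] that(2,3) by blast
      moreover have "u e \<in> \<Omega>s i"
        if "e edge_of \<Omega>" "card (lam e) = 3" "head e \<in> V i \<longrightarrow> tail e \<in> V i" for e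
        using lab'[OF that(1)] that(2,3) i unfolding Vend[OF that(1)] by metis
      moreover have "v e \<in> \<Omega>s i"
        if "e edge_of \<Omega>" "card (lam e) = 3" "tail e \<in> V i \<longrightarrow> head e \<in> V i" for e
        using lab'[OF that(1)] that(2,3) i unfolding Vend[OF that(1)] by metis
      moreover have "V i \<subseteq> \<Omega>s i" by (simp add: V_def)
      ultimately show ?thesis unfolding Vbar_def by blast
    qed
    ultimately show ?thesis by blast
  qed
  then obtain V lam t u v where nice: "nice_skeleton_cover \<Omega> tail head V lam t u v"
    and sub: "\<forall>i\<in>{1,2,3}. Vbar \<Omega> tail head V lam t u v i \<subseteq> \<Omega>s i"
    by (elim exE conjE)
  have "\<Omega>s 1 \<inter> \<Omega>s 2 \<inter> \<Omega>s 3 \<inter> f \<noteq> {}" if f: "f \<in> labelling_faces \<Omega> tail head V lam" for f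
  proof -
    obtain t' u' v' where gen: "generic_skeleton_cover \<Omega> tail head V lam t' u' v'"
      and fm: "f \<in> faces_pairwise_meeting \<Omega> (\<lambda>i. convex hull (Vbar \<Omega> tail head V lam t' u' v' i))"
      using f unfolding labelling_faces_def by blast
    have ff: "f face_of \<Omega>" "aff_dim f = 2" using fm by (auto simp: faces_pairwise_meeting_def)
    note rf = rel_frontier_two_face[OF assms(1) ff]
    have meet: "(\<Omega>s i \<inter> f) \<inter> (\<Omega>s j \<inter> f) \<noteq> {}" if ij: "i \<in> {1,2,3}" "j \<in> {1,2,3}" "i \<noteq> j" for i j
    proof -
      have "convex hull Vbar \<Omega> tail head V lam t' u' v' i \<inter> convex hull Vbar \<Omega> tail head V lam t' u' v' j \<inter> rel_frontier f \<noteq> {}"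
        using fm ij unfolding faces_pairwise_meeting_def by blast
      \<comment> \<open>The boundary of \<open>f\<close> is a union of edges, so the hulls already
        meet on one of them, where the transfer lemma applies.\<close>
      then obtain e where e: "e edge_of \<Omega>" "e \<subseteq> f"
        "convex hull Vbar \<Omega> tail head V lam t' u' v' i \<inter> convex hull Vbar \<Omega> tail head V lam t' u' v' j \<inter> e \<noteq> {}"
        unfolding rf by blast
      have "\<Omega>s i \<inter> \<Omega>s j \<inter> e \<noteq> {}"
        using assms(3)[OF ij(1)] assms(3)[OF ij(2)]
        by (intro generic_hulls_meet_imp_supersets_meet[OF assms(1,2) gen nice e(1) ij(1,2) e(3)
              _ _ bspec[OF sub ij(1)] bspec[OF sub ij(2)]]) simp_all
      then show ?thesis using e(2) by blast
    qed
    have pf: "compact f" "convex f"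
      using face_of_polytope_polytope[OF assms(1) ff(1)] polytope_imp_compact polytope_imp_convex
      by blast+
    \<comment> \<open>The sets \<open>\<Omega>s i\<close> are merely closed; compactness comes from
      the face \<open>f\<close>.\<close>
    then have cc: "compact (\<Omega>s i \<inter> f)" "convex (\<Omega>s i \<inter> f)" if "i \<in> {1,2,3}" for i
      using assms(3)[OF that] by (auto intro: closed_Int_compact convex_Int)
    \<comment> \<open>The traces on \<open>f\<close> cover \<open>f\<close> exactly, so their union
      is convex, as the intersection theorem demands.\<close>
    have "\<Omega>s 1 \<inter> f \<union> \<Omega>s 2 \<inter> f \<union> \<Omega>s 3 \<inter> f = f"
      using assms(4) face_of_imp_subset[OF ff(1)] by auto
    then have "(\<Omega>s 1 \<inter> f) \<inter> (\<Omega>s 2 \<inter> f) \<inter> (\<Omega>s 3 \<inter> f) \<noteq> {}"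
      using pf(2) by (intro three_convex_common_point cc meet) auto
    then show ?thesis by blast
  qed
  then have "\<forall>f\<in>labelling_faces \<Omega> tail head V lam. \<Omega>s 1 \<inter> \<Omega>s 2 \<inter> \<Omega>s 3 \<inter> f \<noteq> {}"
    by (intro ballI)
  with nice sub show ?thesis by (intro exI conjI)
qed

end
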